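(* Let $\langle L,\sqsubseteq,\bot,\top,\sqcap,\sqcup\rangle$ be an atomic complete lattice and let $f:L\to L$ preserve non-empty joins. Let $I\in L$ satisfy $f(I)\sqsubseteq I$. Let $\langle W,\preceq\rangle$ be a well-founded set and $\nu:\{x\in L\mid x\sqsubseteq I\}\to W$ be such that for all $x\sqsubseteq I$, $x\neq f(x)$ implies $\nu(x)\succ\nu(f(x))$. Let $Q\in L$ and assume that for all $x\sqsubseteq I$, $\nu(x)\not\succ\nu(f(x))$ implies $x\sqcap Q=\bot$. Then $\mathrm{lfp}^{\sqsubseteq}f\sqcap Q=\bot$.
   Context: The atoms of a complete lattice $L$ with infimum $\bot$ are the elements $a\in L$ covering $\bot$, i.e.\ $\bot\sqsubset a$ and there is no $x'$ with $\bot\sqsubset x'\sqsubset a$. For $x\in L$, $\mathrm{atoms}(x)$ is the set of atoms $a$ with $a\sqsubseteq x$. $L$ is atomic if $x=\bigsqcup\mathrm{atoms}(x)$ for every $x\in L$. A well-founded set $\langle W,\preceq\rangle$ has no infinite strictly decreasing chain; $\succ$ is the strict converse of $\preceq$. $\mathrm{lfp}^{\sqsubseteq}f$ is the least fixpoint of $f$. *)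

theory Defs
  imports Main "HOL-Library.FuncSet"
begin

definition atom :: "'a::complete_lattice \<Rightarrow> bool" where
  "atom a \<longleftrightarrow> bot < a \<and> \<not> (\<exists>x'. bot < x' \<and> x' < a)"

definition atoms :: "'a::complete_lattice \<Rightarrow> 'a set" where
  "atoms x = {a. atom a \<and> a \<le> x}"

(* The lattice is the whole type 'a; the itself argument names it. *)
definition atomic_lattice :: "'a::complete_lattice itself \<Rightarrow> bool" where
  "atomic_lattice _ \<longleftrightarrow> (\<forall>x::'a. x = Sup (atoms x))"

definition preserves_nonempty_joins :: "('a::complete_lattice \<Rightarrow> 'a) \<Rightarrow> bool" where
  "preserves_nonempty_joins f \<longleftrightarrow> (\<forall>X. X \<noteq> {} \<longrightarrow> f (Sup X) = Sup (f ` X))"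

definition strict_converse :: "('w \<Rightarrow> 'w \<Rightarrow> bool) \<Rightarrow> 'w \<Rightarrow> 'w \<Rightarrow> bool" where
  "strict_converse le u v \<longleftrightarrow> le v u \<and> v \<noteq> u"

(* No order laws are imposed on le: partially ordered W is a special case. *)
definition well_founded_set :: "'w set \<Rightarrow> ('w \<Rightarrow> 'w \<Rightarrow> bool) \<Rightarrow> bool" where
  "well_founded_set W le \<longleftrightarrow>
     \<not> (\<exists>s::nat \<Rightarrow> 'w. \<forall>i. s i \<in> W \<and> strict_converse le (s i) (s (Suc i)))"

lemma well_founded_set_iff_wf:
  "well_founded_set W le \<longleftrightarrow> wf {(v, u). v \<in> W \<and> u \<in> W \<and> strict_converse le u v}"
  unfolding well_founded_set_def wf_iff_no_infinite_down_chain by fastforce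

end

theory Submission
  imports Defs
begin

text \<open>The iterates of \<open>f\<close> from \<open>bot\<close> stay below \<open>I\<close>, so by well-foundedness their ranks stop
  decreasing at some iterate. That iterate is a fixpoint disjoint from \<open>Q\<close>, and it lies above
  the least fixpoint.\<close>

text \<open>Join preservation is applied to the non-empty set \<open>{x, y}\<close>, whose join is
  \<open>y\<close> when \<open>x \<le> y\<close>.\<close>

lemma preserves_nonempty_joins_mono:
  assumes "preserves_nonempty_joins f"
  shows "mono f"
proof (rule monoI)
  fix x y :: 'a
  assume "x \<le> y"
  then have "f y = f (Sup {x, y})"
    by (simp add: sup_absorb2)
  also have "\<dots> = sup (f x) (f y)"
    using assms unfolding preserves_nonempty_joins_def
    by (metis Sup_insert Sup_empty sup_bot_right image_insert image_empty insert_not_empty)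
  finally show "f x \<le> f y"
    by (metis sup_ge1)
qed

theorem mainTheorem6:
  fixes f :: "'a::complete_lattice \<Rightarrow> 'a"
    and I Q :: 'a
    and W :: "'w set"
    and le :: "'w \<Rightarrow> 'w \<Rightarrow> bool"
    and \<nu> :: "'a \<Rightarrow> 'w"
  assumes "atomic_lattice TYPE('a)"
    and "preserves_nonempty_joins f"
    and "f I \<le> I"
    and "well_founded_set W le"
    and "\<nu> \<in> {x. x \<le> I} \<rightarrow> W"
    and "\<And>x. x \<le> I \<Longrightarrow> x \<noteq> f x \<Longrightarrow> strict_converse le (\<nu> x) (\<nu> (f x))"
    and "\<And>x. x \<le> I \<Longrightarrow> \<not> strict_converse le (\<nu> x) (\<nu> (f x)) \<Longrightarrow> inf x Q = bot"
  shows "inf (lfp f) Q = bot"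
proof -
  have "mono f"
    using assms(2) by (rule preserves_nonempty_joins_mono)
  have below: "(f ^^ n) bot \<le> I" for n
  proof (induction n)
    case (Suc n)
    then show ?case
      using monoD[OF \<open>mono f\<close>] assms(3) by (auto intro: order_trans)
  qed simp
  then have "\<nu> ((f ^^ n) bot) \<in> W" for n
    using assms(5) by auto
  \<comment> \<open>Otherwise the ranks of successive iterates would form an infinite strictly
    decreasing chain in \<open>W\<close>.\<close>
  then obtain n where stop: "\<not> strict_converse le (\<nu> ((f ^^ n) bot)) (\<nu> (f ((f ^^ n) bot)))"
    using assms(4) unfolding well_founded_set_def
    by (auto dest: spec[of _ "\<lambda>n. \<nu> ((f ^^ n) bot)"])
  \<comment> \<open>Failure of descent at \<open>n\<close> is used twice: by contraposition it gives
    the fixpoint here, and below it gives disjointness from \<open>Q\<close>.\<close>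
  then have "f ((f ^^ n) bot) = (f ^^ n) bot"
    using assms(6) below by metis
  then have "lfp f \<le> (f ^^ n) bot"
    by (simp add: lfp_lowerbound)
  moreover have "inf ((f ^^ n) bot) Q = bot"
    using assms(7) below stop by blast
  ultimately show ?thesis
    by (metis inf_mono order_refl bot_unique)
qed

end
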